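(* Let $g\in\mathbb{R}_4^+$. The following equivalences hold. (i) ($f*g\in\mathcal{H}_m$ for every $m\in\{1,2,3,4\}$ and every $f\in\mathcal{H}_m$) if and only if $\frac{g*Q_i^3}{x^i}\in\mathcal{H}_3^\star$ for $i=0,1$. (ii) ($f*g\in\mathcal{H}_m^\star$ for every $m\in\{1,2,3,4\}$ and every $f\in\mathcal{H}_m^\star$) if and only if $\frac{g*Q_i^3}{x^i}\in\mathcal{H}_3^\star$ for $i=0,1$. Hence $X_4=Y_4=\overline{\mathcal{W}_4}$.
   Context: $\mathbb{R}_n^+$ denotes the set of real polynomials of degree $n$ all of whose coefficients (of $x^0,\dots,x^n$) are positive. $\mathcal{H}_n$ is the set of $f\in\mathbb{R}_n^+$ all of whose complex zeros $z$ satisfy $\Re(z)<0$. $\mathcal{H}_n^\star$ is the set of real polynomials $f(x)=\sum_{i=0}^n a_ix^i$ with $a_0,a_n>0$, $a_i\ge 0$ for $1\le i\le n-1$, all of whose complex zeros $z$ satisfy $\Re(z)\le 0$. The Hadamard product of $f(x)=\sum_{i=0}^n a_ix^i$ and $g(x)=\sum_{i=0}^m b_ix^i$ is $(f*g)(x)=\sum_{i=0}^{\min\{n,m\}}a_ib_ix^i$. $X_n=\{g\in\mathbb{R}_n^+ : f*g\in\mathcal{H}_m \text{ for all } 1\le m\le n \text{ and all } f\in\mathcal{H}_m\}$. $Q^k(x)=(x^2+1)^l$ if $k=2l$, and $Q^k(x)=(x^2+1)^l+x(x^2+1)^l$ if $k=2l+1$; $Q_m^k(x)=x^mQ^k(x)$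 for integers $m\ge 0$. $Y_n=\{g\in\mathbb{R}_n^+ : \frac{(g*Q_m^k)(x)}{x^m}\in\mathcal{H}_k^\star \text{ for all integers } k\ge 2,\ m\ge 0 \text{ with } k+m\le n\}$. $\overline{\mathcal{W}_4}=\{g\in\mathbb{R}_4^+,\ g(x)=\sum_{i=0}^4 b_ix^i : b_ib_{i-1}\ge b_{i-2}b_{i+1}\ (i=2,3)\}$. *)

theory Defs
  imports "HOL-Computational_Algebra.Computational_Algebra" Complex_Main
begin

definition pos_polys :: "nat \<Rightarrow> real poly set" where
  "pos_polys n = {f. degree f = n \<and> (\<forall>i\<le>n. coeff f i > 0)}"

definition hurwitz :: "nat \<Rightarrow> real poly set" where
  "hurwitz n = {f \<in> pos_polys n.
     \<forall>z::complex. poly (map_poly complex_of_real f) z = 0 \<longrightarrow> Re z < 0}"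

definition quasi_hurwitz :: "nat \<Rightarrow> real poly set" where
  "quasi_hurwitz n = {f. degree f = n \<and> coeff f 0 > 0 \<and> coeff f n > 0 \<and>
     (\<forall>i. 1 \<le> i \<and> i \<le> n - 1 \<longrightarrow> coeff f i \<ge> 0) \<and>
     (\<forall>z::complex. poly (map_poly complex_of_real f) z = 0 \<longrightarrow> Re z \<le> 0)}"

definition hadamard :: "real poly \<Rightarrow> real poly \<Rightarrow> real poly" where
  "hadamard f g = (\<Sum>i\<le>min (degree f) (degree g). monom (coeff f i * coeff g i) i)"

lemma coeff_hadamard: "coeff (hadamard f g) i = coeff f i * coeff g i"
  by (auto simp: hadamard_def coeff_sum coeff_eq_0 not_le min_le_iff_disj)

definition Q :: "nat \<Rightarrow> real poly" where
  "Q k = (if even k then [:1, 0, 1:] ^ (k div 2)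
          else [:1, 0, 1:] ^ (k div 2) + [:0, 1:] * [:1, 0, 1:] ^ (k div 2))"

definition Q_shift :: "nat \<Rightarrow> nat \<Rightarrow> real poly" where
  "Q_shift m k = monom 1 m * Q k"

text \<open>The quotient by \<open>x ^ m\<close> below is exact, so polynomial division renders it faithfully.\<close>

lemma monom_dvd_hadamard_Q_shift: "monom 1 m dvd hadamard g (Q_shift m k)"
  by (simp add: monom_1_dvd_iff' coeff_hadamard Q_shift_def coeff_monom_mult)

definition hadamard_Q_quot :: "real poly \<Rightarrow> nat \<Rightarrow> nat \<Rightarrow> real poly" where
  "hadamard_Q_quot g m k = hadamard g (Q_shift m k) div monom 1 m"

definition X :: "nat \<Rightarrow> real poly set" where
  "X n = {g \<in> pos_polys n.
     \<forall>m. 1 \<le> m \<and> m \<le> n \<longrightarrow> (\<forall>f\<in>hurwitz m. hadamard f g \<in> hurwitz m)}"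

definition Y :: "nat \<Rightarrow> real poly set" where
  "Y n = {g \<in> pos_polys n.
     \<forall>k m. k \<ge> 2 \<and> k + m \<le> n \<longrightarrow> hadamard_Q_quot g m k \<in> quasi_hurwitz k}"

definition W4_bar :: "real poly set" where
  "W4_bar = {g \<in> pos_polys 4.
     \<forall>i\<in>{2, 3}. coeff g i * coeff g (i - 1) \<ge> coeff g (i - 2) * coeff g (i + 1)}"

end

theory Submission
  imports Defs
begin

text \<open>
  A real polynomial of degree \<open>4\<close> splits as \<open>(x\<^sup>2 + p x + q) (c x\<^sup>2 + r x + s)\<close>, and its Hurwitz
  determinant \<open>a\<^sub>1 a\<^sub>2 a\<^sub>3 - a\<^sub>0 a\<^sub>3\<^sup>2 - a\<^sub>1\<^sup>2 a\<^sub>4\<close> then equals \<open>p r ((s - q c)\<^sup>2 + a\<^sub>1 a\<^sub>3)\<close>; similarly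
  \<open>a\<^sub>1 a\<^sub>2 - a\<^sub>0 a\<^sub>3 = p (s\<^sup>2 + a\<^sub>1 a\<^sub>3)\<close> for \<open>(x\<^sup>2 + p x + q) (c x + s)\<close>. Since the linear coefficients \<open>p\<close>
  and \<open>r\<close> carry the signs of the real parts of the zeros, this yields the Hurwitz criteria in degrees
  \<open>3\<close> and \<open>4\<close>. In terms of the coefficients of \<open>g\<close>, the conditions on \<open>Q\<^sup>3\<close> are exactly
  \<open>b\<^sub>0 b\<^sub>3 \<le> b\<^sub>1 b\<^sub>2\<close> and \<open>b\<^sub>1 b\<^sub>4 \<le> b\<^sub>2 b\<^sub>3\<close>; multiplying a criterion for \<open>f\<close> by these gives the criterion for
  \<open>f * g\<close>. Conversely, both inequalities are limits of the criterion for \<open>f * g\<close> with \<open>f\<close> close to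
  \<open>1 + x + x\<^sup>2 + x\<^sup>3\<close> and to \<open>x (1 + x + x\<^sup>2 + x\<^sup>3)\<close>.
\<close>

section \<open>Real polynomials at complex points\<close>

abbreviation cpoly :: "real poly \<Rightarrow> complex \<Rightarrow> complex" where
  "cpoly f z \<equiv> poly (map_poly complex_of_real f) z"

lemma cpoly_mult: "cpoly (f * g) z = cpoly f z * cpoly g z"
proof -
  have "map_poly complex_of_real (f * g) = map_poly complex_of_real f * map_poly complex_of_real g"
    by (intro poly_eqI) (simp add: coeff_map_poly coeff_mult)
  then show ?thesis by simp
qed

lemma cpoly_add: "cpoly (f + g) z = cpoly f z + cpoly g z"
proof -
  have "map_poly complex_of_real (f + g) = map_poly complex_of_real f + map_poly complex_of_real g"
    by (intro poly_eqI) (simp add: coeff_map_poly)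
  then show ?thesis by simp
qed

lemma cpoly_of_real: "cpoly f (complex_of_real x) = complex_of_real (poly f x)"
  by (induction f) (simp_all add: map_poly_pCons)

lemma cpoly_dvd_root: "g dvd f \<Longrightarrow> cpoly g z = 0 \<Longrightarrow> cpoly f z = 0"
  by (auto simp: dvd_def cpoly_mult)

lemma cpoly_root_exists:
  assumes "degree f \<noteq> 0"
  shows "\<exists>z. cpoly f z = 0"
proof (rule fundamental_theorem_of_algebra)
  have "degree (map_poly complex_of_real f) = degree f"
    using assms by (intro map_poly_degree_eq) auto
  with assms show "\<not> constant (poly (map_poly complex_of_real f))"
    by (simp add: constant_degree)
qed

section \<open>Real quadratic divisors and the real parts of zeros\<close>

text \<open>The quadratic has the zeros \<open>z\<close> and its conjugate. The remainder of
  \<open>f\<close> modulo it is real, of degree at most 1, and vanishes at the nonreal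
  \<open>z\<close>, hence is 0.\<close>

lemma quadratic_dvd_of_nonreal_root:
  assumes root: "cpoly f z = 0" and "Im z \<noteq> 0"
  shows "[:(cmod z)\<^sup>2, - 2 * Re z, 1:] dvd f"
proof -
  let ?d = "[:(cmod z)\<^sup>2, - 2 * Re z, 1:]"
  define h where "h = f mod ?d"
  have "degree h < 2"
    using degree_mod_less'[of ?d f] by (cases "h = 0") (auto simp: h_def)
  then have h: "h = [:coeff h 0, coeff h 1:]"
    by (intro poly_eqI) (auto simp: coeff_pCons coeff_eq_0 split: nat.split)
  have d: "cpoly ?d z = 0"
    unfolding cmod_power2
    by (simp add: complex_eq_iff map_poly_pCons power2_eq_square algebra_simps)
  have "f = f div ?d * ?d + h"
    unfolding h_def by (rule div_mult_mod_eq[symmetric])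
  then have "cpoly f z = cpoly (f div ?d) z * cpoly ?d z + cpoly h z"
    by (metis cpoly_add cpoly_mult)
  then have "cpoly h z = 0"
    using root d by simp
  then have "complex_of_real (coeff h 0) + z * complex_of_real (coeff h 1) = 0"
    by (subst (asm) h) (simp add: map_poly_pCons)
  then have "coeff h 1 = 0" "coeff h 0 = 0"
    using \<open>Im z \<noteq> 0\<close> by (auto simp: complex_eq_iff)
  with h have "h = 0" by simp
  then show ?thesis by (simp add: h_def dvd_eq_mod_eq_0)
qed

text \<open>A nonreal zero contributes the quadratic it shares with its conjugate. A real zero
  leaves a nonconstant cofactor, whose zero again either is nonreal or supplies a second linear
  factor.\<close>

lemma monic_quadratic_dvd_exists:
  fixes f :: "real poly"
  assumes "degree f \<ge> 2"
  shows "\<exists>p q. [:q, p, 1:] dvd f"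
proof -
  obtain z where z: "cpoly f z = 0"
    using cpoly_root_exists[of f] assms by auto
  show ?thesis
  proof (cases "Im z = 0")
    case False
    then show ?thesis using quadratic_dvd_of_nonreal_root[OF z] by blast
  next
    case True
    then obtain x where x: "z = complex_of_real x"
      by (metis complex_is_Real_iff Reals_cases)
    then have "poly f x = 0"
      using z by (simp add: cpoly_of_real)
    then obtain h where h: "f = [:- x, 1:] * h"
      by (auto simp: poly_eq_0_iff_dvd dvd_def)
    have "h \<noteq> 0" using h assms by auto
    then have "degree h \<noteq> 0"
      using assms degree_mult_eq[of "[:- x, 1:]" h] by (simp add: h del: mult_pCons_left)
    then obtain w where w: "cpoly h w = 0"
      using cpoly_root_exists by blast
    show ?thesis
    proof (cases "Im w = 0")
      case False
      then show ?thesis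
        using quadratic_dvd_of_nonreal_root[OF w] h dvd_mult by blast
    next
      case True
      then obtain y where "w = complex_of_real y"
        by (metis complex_is_Real_iff Reals_cases)
      then have "poly h y = 0"
        using w by (simp add: cpoly_of_real)
      then have "[:- y, 1:] dvd h"
        by (simp add: poly_eq_0_iff_dvd)
      then have "[:- x, 1:] * [:- y, 1:] dvd f"
        unfolding h by (rule mult_dvd_mono[OF dvd_refl])
      moreover have "[:- x, 1:] * [:- y, 1:] = [:x * y, - x - y, 1:]"
        by (simp add: algebra_simps)
      ultimately show ?thesis by metis
    qed
  qed
qed

text \<open>The zero obtained by adding the principal square root of the discriminant works, since
  \<open>csqrt\<close> has nonnegative real part. Real and nonreal zeros are thus treated
  alike.\<close>

lemma quadratic_root_Re_ge:
  fixes r s c :: real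
  assumes "c > 0"
  obtains z where "cpoly [:s, r, c:] z = 0" "Re z \<ge> - r / (2 * c)"
proof
  define w where "w = csqrt (complex_of_real (r\<^sup>2 - 4 * s * c))"
  define z where "z = (w - complex_of_real r) / complex_of_real (2 * c)"
  have w2: "w * w = complex_of_real r * complex_of_real r - 4 * complex_of_real s * complex_of_real c"
    using power2_csqrt[of "complex_of_real (r\<^sup>2 - 4 * s * c)"]
    by (simp add: w_def power2_eq_square)
  have z: "2 * complex_of_real c * z = w - complex_of_real r"
    using assms by (simp add: z_def)
  \<comment> \<open>Scaling by \<open>4 * c\<close> turns the quadratic into a polynomial in
    \<open>2 * c * z\<close>, which equals \<open>w - r\<close>.\<close>
  have "4 * complex_of_real c * cpoly [:s, r, c:] z =
      4 * complex_of_real s * complex_of_real c + 2 * complex_of_real r * (2 * complex_of_real c * z)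
      + (2 * complex_of_real c * z) * (2 * complex_of_real c * z)"
    by (simp add: map_poly_pCons algebra_simps)
  also have "\<dots> = 0"
    unfolding z using w2 by (simp add: algebra_simps)
  finally show "cpoly [:s, r, c:] z = 0"
    using assms by simp
  have "Re z = (Re w - r) / (2 * c)"
    unfolding z_def by (subst Re_divide_of_real) simp
  moreover have "Re w \<ge> 0"
    unfolding w_def using Re_csqrt by blast
  ultimately show "Re z \<ge> - r / (2 * c)"
    using assms by (simp add: diff_divide_distrib)
qed

text \<open>Some zero of the divisor has real part at least \<open>- r / (2 * c)\<close>. It is also
  a zero of \<open>f\<close>, so this bound cannot be positive.\<close>

lemma quadratic_dvd_linear_coeff_nonneg:
  assumes "[:s, r, c:] dvd f" "c > 0" "\<forall>z. cpoly f z = 0 \<longrightarrow> Re z \<le> 0"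
  shows "r \<ge> 0"
proof -
  obtain z where "cpoly [:s, r, c:] z = 0" and z: "Re z \<ge> - r / (2 * c)"
    using quadratic_root_Re_ge[OF \<open>c > 0\<close>] .
  then have "Re z \<le> 0"
    using assms cpoly_dvd_root by blast
  with z have "- r / (2 * c) \<le> 0" by linarith
  with \<open>c > 0\<close> show ?thesis by (simp add: zero_le_divide_iff)
qed

lemma quadratic_dvd_linear_coeff_pos:
  assumes "[:s, r, c:] dvd f" "c > 0" "\<forall>z. cpoly f z = 0 \<longrightarrow> Re z < 0"
  shows "r > 0"
proof -
  obtain z where "cpoly [:s, r, c:] z = 0" and z: "Re z \<ge> - r / (2 * c)"
    using quadratic_root_Re_ge[OF \<open>c > 0\<close>] .
  then have "Re z < 0"
    using assms cpoly_dvd_root by blast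
  with z have "- r / (2 * c) < 0" by linarith
  with \<open>c > 0\<close> show ?thesis by (simp add: zero_less_divide_iff)
qed

text \<open>Real zeros are negative because of the signs of the coefficients, so only the quadratic
  factors of non-real zeros matter.\<close>

lemma root_Re_cases:
  fixes f :: "real poly"
  assumes "cpoly f z = 0" "coeff f 0 > 0" "\<And>i. coeff f i \<ge> 0"
  obtains "Re z < 0" | "[:(cmod z)\<^sup>2, - 2 * Re z, 1:] dvd f" "(cmod z)\<^sup>2 > 0"
proof (cases "Im z = 0")
  case False
  moreover have "(cmod z)\<^sup>2 > 0"
    using False by (auto simp: complex_eq_iff)
  ultimately show ?thesis
    using quadratic_dvd_of_nonreal_root[OF assms(1)] that by blast
next
  case True
  then obtain x where x: "z = complex_of_real x"
    by (metis complex_is_Real_iff Reals_cases)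
  have "x < 0"
  proof (rule ccontr)
    assume "\<not> x < 0"
    \<comment> \<open>At \<open>x \<ge> 0\<close> every summand of \<open>f\<close> is nonnegative,
      so the value is at least the constant term, which is positive.\<close>
    then have "coeff f 0 * x ^ 0 \<le> (\<Sum>i\<le>degree f. coeff f i * x ^ i)"
      using assms(3) by (intro member_le_sum) auto
    moreover have "poly f x = 0"
      using assms(1) x by (simp add: cpoly_of_real)
    ultimately show False
      using assms(2) by (simp add: poly_altdef)
  qed
  then show ?thesis using x that(1) by simp
qed

section \<open>Splitting off a quadratic factor; Hurwitz determinants\<close>

lemma quadratic_factor:
  fixes f :: "real poly"
  assumes "degree f = 2" "[:q, p, 1:] dvd f"
  shows "coeff f 1 = p * coeff f 2"
proof -
  obtain h where h: "f = [:q, p, 1:] * h" using assms(2) by (auto simp: dvd_def)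
  have "h \<noteq> 0" using h assms(1) by auto
  then have "degree h = 0"
    using assms(1) degree_mult_eq[of "[:q, p, 1:]" h] by (simp add: h del: mult_pCons_left)
  then obtain c where "h = [:c:]" by (rule degree_eq_zeroE)
  then show ?thesis by (simp add: h coeff_pCons numeral_2_eq_2)
qed

lemma cubic_factor:
  fixes f :: "real poly"
  assumes "degree f = 3" "[:q, p, 1:] dvd f"
  obtains s where "coeff f 0 = q * s" "coeff f 1 = p * s + q * coeff f 3"
    "coeff f 2 = s + p * coeff f 3"
proof -
  obtain h where h: "f = [:q, p, 1:] * h" using assms(2) by (auto simp: dvd_def)
  have "h \<noteq> 0" using h assms(1) by auto
  then have "degree h = 1"
    using assms(1) degree_mult_eq[of "[:q, p, 1:]" h] by (simp add: h del: mult_pCons_left)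
  then have "h = [:coeff h 0, coeff h 1:]"
    by (intro poly_eqI) (auto simp: coeff_pCons coeff_eq_0 split: nat.split)
  then obtain s c where "h = [:s, c:]" by blast
  then show ?thesis
    using that[of s] by (simp add: h coeff_pCons numeral_2_eq_2 numeral_3_eq_3)
qed

text \<open>Coefficients are compared with those of the product with the cofactor
  \<open>[:s, r, coeff f 4:]\<close>. The cofactor is returned as a divisor too, because the sign of
  \<open>r\<close> also has to be read off from the zeros.\<close>

lemma quartic_factor:
  fixes f :: "real poly"
  assumes "degree f = 4" "[:q, p, 1:] dvd f"
  obtains s r where "coeff f 0 = q * s" "coeff f 1 = p * s + q * r"
    "coeff f 2 = s + p * r + q * coeff f 4" "coeff f 3 = r + p * coeff f 4"
    "[:s, r, coeff f 4:] dvd f"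
proof -
  obtain h where h: "f = [:q, p, 1:] * h" using assms(2) by (auto simp: dvd_def)
  have "h \<noteq> 0" using h assms(1) by auto
  then have "degree h = 2"
    using assms(1) degree_mult_eq[of "[:q, p, 1:]" h] by (simp add: h del: mult_pCons_left)
  then have "h = [:coeff h 0, coeff h 1, coeff h 2:]"
    by (intro poly_eqI) (auto simp: coeff_pCons coeff_eq_0 numeral_2_eq_2 split: nat.split)
  then obtain s r c where hc: "h = [:s, r, c:]" by blast
  have c: "coeff f 4 = c"
    by (simp add: h hc coeff_pCons eval_nat_numeral)
  show ?thesis
  proof (rule that[of s r, unfolded c])
    show "[:s, r, c:] dvd f" unfolding h hc by (rule dvd_triv_right)
  qed (simp_all add: h hc coeff_pCons eval_nat_numeral)
qed

lemma hurwitz_det_cubic: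
  fixes p q s c :: real
  assumes "a0 = q * s" "a1 = p * s + q * c" "a2 = s + p * c"
  shows "a1 * a2 - a0 * c = p * (s\<^sup>2 + a1 * c)"
  unfolding assms by algebra

text \<open>Once \<open>a1 * a3 > 0\<close> the last factor is positive, so the determinant has the
  sign of \<open>p * r\<close>.\<close>

lemma hurwitz_det_quartic:
  fixes p q r s c :: real
  assumes "a0 = q * s" "a1 = p * s + q * r" "a2 = s + p * r + q * c" "a3 = r + p * c"
  shows "a1 * a2 * a3 - (a0 * a3\<^sup>2 + a1\<^sup>2 * c) = p * r * ((s - q * c)\<^sup>2 + a1 * a3)"
  unfolding assms by algebra

section \<open>Hurwitz criteria in degrees 1 to 4\<close>

lemma pos_polys_coeff_nonneg: "f \<in> pos_polys n \<Longrightarrow> coeff f i \<ge> 0"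
  unfolding pos_polys_def by (cases "i \<le> n") (auto simp: coeff_eq_0 less_imp_le)

lemma quasi_hurwitz_coeff_nonneg:
  assumes "f \<in> quasi_hurwitz n"
  shows "coeff f i \<ge> 0"
proof -
  consider "i = 0" | "i = n" | "n < i" | "1 \<le> i \<and> i \<le> n - 1" by linarith
  then show ?thesis
    using assms by cases (simp_all add: quasi_hurwitz_def coeff_eq_0 less_imp_le)
qed

text \<open>A quadratic cannot divide a linear polynomial, so only the first case of
  \<open>root_Re_cases\<close> can occur.\<close>

lemma hurwitz_1_iff: "f \<in> hurwitz 1 \<longleftrightarrow> f \<in> pos_polys 1"
proof
  assume f: "f \<in> pos_polys 1"
  have "Re z < 0" if z: "cpoly f z = 0" for z
    using z
  proof (rule root_Re_cases)
    assume "[:(cmod z)\<^sup>2, - 2 * Re z, 1:] dvd f"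
    then have "degree [:(cmod z)\<^sup>2, - 2 * Re z, 1:] \<le> degree f"
      using f by (intro dvd_imp_degree_le) (auto simp: pos_polys_def)
    then show "Re z < 0" using f by (simp add: pos_polys_def)
  qed (use f pos_polys_coeff_nonneg in \<open>auto simp: pos_polys_def\<close>)
  with f show "f \<in> hurwitz 1" by (auto simp: hurwitz_def)
qed (auto simp: hurwitz_def)

lemma hurwitz_2_iff: "f \<in> hurwitz 2 \<longleftrightarrow> f \<in> pos_polys 2"
proof
  assume f: "f \<in> pos_polys 2"
  have "Re z < 0" if z: "cpoly f z = 0" for z
    using z
  proof (rule root_Re_cases)
    assume "[:(cmod z)\<^sup>2, - 2 * Re z, 1:] dvd f"
    then have "coeff f 1 = - 2 * Re z * coeff f 2"
      using f by (intro quadratic_factor) (auto simp: pos_polys_def)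
    moreover have "coeff f 1 > 0" "coeff f 2 > 0" using f by (auto simp: pos_polys_def)
    ultimately show "Re z < 0" by (simp add: mult_less_0_iff)
  qed (use f pos_polys_coeff_nonneg in \<open>auto simp: pos_polys_def\<close>)
  with f show "f \<in> hurwitz 2" by (auto simp: hurwitz_def)
qed (auto simp: hurwitz_def)

text \<open>The determinant is \<open>p\<close> times a positive number for every divisor
  \<open>[:q, p, 1:]\<close>. Necessity uses an arbitrary such divisor, sufficiency the one with
  \<open>p = - 2 * Re z\<close> attached to a zero.\<close>

lemma hurwitz_3_iff:
  "f \<in> hurwitz 3 \<longleftrightarrow> f \<in> pos_polys 3 \<and> coeff f 0 * coeff f 3 < coeff f 1 * coeff f 2"
proof (cases "f \<in> pos_polys 3")
  case f: True
  then have deg: "degree f = 3" and pos: "coeff f 0 > 0" "coeff f 1 > 0" "coeff f 2 > 0" "coeff f 3 > 0"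
    by (auto simp: pos_polys_def)
  have "(\<forall>z. cpoly f z = 0 \<longrightarrow> Re z < 0) \<longleftrightarrow> coeff f 0 * coeff f 3 < coeff f 1 * coeff f 2"
  proof safe
    assume roots: "\<forall>z. cpoly f z = 0 \<longrightarrow> Re z < 0"
    obtain p q where d: "[:q, p, 1:] dvd f"
      using deg monic_quadratic_dvd_exists[of f] by auto
    obtain s where s: "coeff f 0 = q * s" "coeff f 1 = p * s + q * coeff f 3"
      "coeff f 2 = s + p * coeff f 3"
      using cubic_factor[OF deg d] .
    have "p > 0" using quadratic_dvd_linear_coeff_pos[OF d _ roots] by simp
    moreover have "s\<^sup>2 + coeff f 1 * coeff f 3 > 0"
      using pos by (intro add_nonneg_pos) auto
    ultimately have "p * (s\<^sup>2 + coeff f 1 * coeff f 3) > 0"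
      by (rule mult_pos_pos)
    then show "coeff f 0 * coeff f 3 < coeff f 1 * coeff f 2"
      using hurwitz_det_cubic[OF s] by linarith
  next
    fix z assume det: "coeff f 0 * coeff f 3 < coeff f 1 * coeff f 2" and "cpoly f z = 0"
    from this(2) show "Re z < 0"
    proof (rule root_Re_cases)
      assume d: "[:(cmod z)\<^sup>2, - 2 * Re z, 1:] dvd f"
      obtain s where s: "coeff f 0 = (cmod z)\<^sup>2 * s" "coeff f 1 = - 2 * Re z * s + (cmod z)\<^sup>2 * coeff f 3"
        "coeff f 2 = s + - 2 * Re z * coeff f 3"
        using cubic_factor[OF deg d] .
      have "s\<^sup>2 + coeff f 1 * coeff f 3 > 0"
        using pos by (intro add_nonneg_pos) auto
      moreover have "- 2 * Re z * (s\<^sup>2 + coeff f 1 * coeff f 3) > 0"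
        using hurwitz_det_cubic[OF s] det by linarith
      ultimately show "Re z < 0"
        by (simp add: mult_less_0_iff)
    qed (use pos pos_polys_coeff_nonneg[OF f] in auto)
  qed
  with f show ?thesis by (auto simp: hurwitz_def)
qed (auto simp: hurwitz_def)

lemma hurwitz_4_iff:
  "f \<in> hurwitz 4 \<longleftrightarrow> f \<in> pos_polys 4 \<and>
     coeff f 0 * (coeff f 3)\<^sup>2 + (coeff f 1)\<^sup>2 * coeff f 4 < coeff f 1 * coeff f 2 * coeff f 3"
proof (cases "f \<in> pos_polys 4")
  case f: True
  let ?det = "coeff f 0 * (coeff f 3)\<^sup>2 + (coeff f 1)\<^sup>2 * coeff f 4 < coeff f 1 * coeff f 2 * coeff f 3"
  from f have deg: "degree f = 4"
    and pos: "coeff f 0 > 0" "coeff f 1 > 0" "coeff f 2 > 0" "coeff f 3 > 0" "coeff f 4 > 0"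
    by (auto simp: pos_polys_def)
  have pos13: "x\<^sup>2 + coeff f 1 * coeff f 3 > 0" for x
    using pos by (intro add_nonneg_pos) auto
  have "(\<forall>z. cpoly f z = 0 \<longrightarrow> Re z < 0) \<longleftrightarrow> ?det"
  proof safe
    assume roots: "\<forall>z. cpoly f z = 0 \<longrightarrow> Re z < 0"
    obtain p q where d: "[:q, p, 1:] dvd f"
      using deg monic_quadratic_dvd_exists[of f] by auto
    obtain s r where s: "coeff f 0 = q * s" "coeff f 1 = p * s + q * r"
      "coeff f 2 = s + p * r + q * coeff f 4" "coeff f 3 = r + p * coeff f 4"
      and d': "[:s, r, coeff f 4:] dvd f"
      using quartic_factor[OF deg d] .
    have "p > 0" "r > 0"
      using quadratic_dvd_linear_coeff_pos[OF d _ roots]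
        quadratic_dvd_linear_coeff_pos[OF d' _ roots] pos by auto
    then have "p * r * ((s - q * coeff f 4)\<^sup>2 + coeff f 1 * coeff f 3) > 0"
      using pos13 by simp
    then show ?det
      using hurwitz_det_quartic[OF s] by linarith
  next
    fix z assume det: ?det and "cpoly f z = 0"
    from this(2) show "Re z < 0"
    proof (rule root_Re_cases)
      define p q where pq: "p = - 2 * Re z" "q = (cmod z)\<^sup>2"
      assume "[:(cmod z)\<^sup>2, - 2 * Re z, 1:] dvd f"
      then have d: "[:q, p, 1:] dvd f" by (simp add: pq)
      obtain s r where s: "coeff f 0 = q * s" "coeff f 1 = p * s + q * r"
        "coeff f 2 = s + p * r + q * coeff f 4" "coeff f 3 = r + p * coeff f 4"
        using quartic_factor[OF deg d] .
      have "p * r * ((s - q * coeff f 4)\<^sup>2 + coeff f 1 * coeff f 3) > 0"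
        using hurwitz_det_quartic[OF s] det by linarith
      then have "p * r > 0"
        using pos13 by (rule zero_less_mult_pos2)
      \<comment> \<open>The determinant only shows that \<open>p\<close> and \<open>r\<close> have
        equal signs; the positive cubic coefficient rules out that both are negative.\<close>
      moreover have "r > 0 \<or> p > 0"
        using s(4) pos mult_nonpos_nonneg[of p "coeff f 4"] by linarith
      ultimately have "p > 0"
        by (auto simp: zero_less_mult_iff)
      then show "Re z < 0" by (simp add: pq)
    qed (use pos pos_polys_coeff_nonneg[OF f] in auto)
  qed
  with f show ?thesis by (auto simp: hurwitz_def)
qed (auto simp: hurwitz_def)

section \<open>Quasi-Hurwitz criteria in degrees 1 to 4\<close>

text \<open>The coefficient conditions of \<open>quasi_hurwitz\<close>. Nonnegativity is asked at
  every index, which is equivalent because coefficients beyond the degree vanish, and which avoids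
  index ranges.\<close>

definition nonneg_polys :: "nat \<Rightarrow> real poly set" where
  "nonneg_polys n = {f. degree f = n \<and> coeff f 0 > 0 \<and> coeff f n > 0 \<and> (\<forall>i. coeff f i \<ge> 0)}"

lemma quasi_hurwitz_iff:
  "f \<in> quasi_hurwitz n \<longleftrightarrow> f \<in> nonneg_polys n \<and> (\<forall>z. cpoly f z = 0 \<longrightarrow> Re z \<le> 0)"
proof
  assume f: "f \<in> quasi_hurwitz n"
  then show "f \<in> nonneg_polys n \<and> (\<forall>z. cpoly f z = 0 \<longrightarrow> Re z \<le> 0)"
    using quasi_hurwitz_coeff_nonneg[OF f] by (simp add: quasi_hurwitz_def nonneg_polys_def)
qed (simp add: quasi_hurwitz_def nonneg_polys_def)

lemma quasi_hurwitz_1_iff: "f \<in> quasi_hurwitz 1 \<longleftrightarrow> f \<in> nonneg_polys 1"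
proof
  assume f: "f \<in> nonneg_polys 1"
  have "Re z \<le> 0" if z: "cpoly f z = 0" for z
    using z
  proof (rule root_Re_cases)
    assume "[:(cmod z)\<^sup>2, - 2 * Re z, 1:] dvd f"
    then have "degree [:(cmod z)\<^sup>2, - 2 * Re z, 1:] \<le> degree f"
      using f by (intro dvd_imp_degree_le) (auto simp: nonneg_polys_def)
    then show "Re z \<le> 0" using f by (simp add: nonneg_polys_def)
  qed (use f in \<open>auto simp: nonneg_polys_def\<close>)
  with f show "f \<in> quasi_hurwitz 1" by (auto simp: quasi_hurwitz_iff)
qed (auto simp: quasi_hurwitz_iff)

lemma quasi_hurwitz_2_iff: "f \<in> quasi_hurwitz 2 \<longleftrightarrow> f \<in> nonneg_polys 2"
proof
  assume f: "f \<in> nonneg_polys 2"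
  have "Re z \<le> 0" if z: "cpoly f z = 0" for z
    using z
  proof (rule root_Re_cases)
    assume "[:(cmod z)\<^sup>2, - 2 * Re z, 1:] dvd f"
    then have "coeff f 1 = - 2 * Re z * coeff f 2"
      using f by (intro quadratic_factor) (auto simp: nonneg_polys_def)
    moreover have "coeff f 1 \<ge> 0" "coeff f 2 > 0" using f by (auto simp: nonneg_polys_def)
    ultimately show "Re z \<le> 0" by (simp add: mult_le_0_iff)
  qed (use f in \<open>auto simp: nonneg_polys_def\<close>)
  with f show "f \<in> quasi_hurwitz 2" by (auto simp: quasi_hurwitz_iff)
qed (auto simp: quasi_hurwitz_iff)

lemma quasi_hurwitz_3_iff:
  "f \<in> quasi_hurwitz 3 \<longleftrightarrow> f \<in> nonneg_polys 3 \<and> coeff f 0 * coeff f 3 \<le> coeff f 1 * coeff f 2"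
proof (cases "f \<in> nonneg_polys 3")
  case f: True
  then have deg: "degree f = 3" and pos: "coeff f 0 > 0" "coeff f 3 > 0"
    and nonneg: "\<And>i. coeff f i \<ge> 0"
    by (auto simp: nonneg_polys_def)
  have "(\<forall>z. cpoly f z = 0 \<longrightarrow> Re z \<le> 0) \<longleftrightarrow> coeff f 0 * coeff f 3 \<le> coeff f 1 * coeff f 2"
  proof safe
    assume roots: "\<forall>z. cpoly f z = 0 \<longrightarrow> Re z \<le> 0"
    obtain p q where d: "[:q, p, 1:] dvd f"
      using deg monic_quadratic_dvd_exists[of f] by auto
    obtain s where s: "coeff f 0 = q * s" "coeff f 1 = p * s + q * coeff f 3"
      "coeff f 2 = s + p * coeff f 3"
      using cubic_factor[OF deg d] .
    have "p \<ge> 0" using quadratic_dvd_linear_coeff_nonneg[OF d _ roots] by simp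
    then have "p * (s\<^sup>2 + coeff f 1 * coeff f 3) \<ge> 0"
      using nonneg by simp
    then show "coeff f 0 * coeff f 3 \<le> coeff f 1 * coeff f 2"
      using hurwitz_det_cubic[OF s] by linarith
  next
    fix z assume det: "coeff f 0 * coeff f 3 \<le> coeff f 1 * coeff f 2" and "cpoly f z = 0"
    from this(2) show "Re z \<le> 0"
    proof (rule root_Re_cases)
      assume d: "[:(cmod z)\<^sup>2, - 2 * Re z, 1:] dvd f"
      obtain s where s: "coeff f 0 = (cmod z)\<^sup>2 * s" "coeff f 1 = - 2 * Re z * s + (cmod z)\<^sup>2 * coeff f 3"
        "coeff f 2 = s + - 2 * Re z * coeff f 3"
        using cubic_factor[OF deg d] .
      \<comment> \<open>The weak inequality still has a positive left side, which excludes
        \<open>coeff f 1 = 0\<close> and so makes the cofactor of \<open>- 2 * Re z\<close> in the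
        determinant positive.\<close>
      have "coeff f 1 * coeff f 2 > 0"
        using pos det mult_pos_pos[of "coeff f 0" "coeff f 3"] by linarith
      then have "coeff f 1 > 0"
        using nonneg[of 1] by (cases "coeff f 1 = 0") auto
      then have "s\<^sup>2 + coeff f 1 * coeff f 3 > 0"
        using pos by (intro add_nonneg_pos) auto
      moreover have "- 2 * Re z * (s\<^sup>2 + coeff f 1 * coeff f 3) \<ge> 0"
        using hurwitz_det_cubic[OF s] det by linarith
      ultimately show "Re z \<le> 0"
        by (simp add: mult_le_0_iff)
    qed (use pos nonneg in auto)
  qed
  with f show ?thesis by (auto simp: quasi_hurwitz_iff)
qed (auto simp: quasi_hurwitz_iff)

text \<open>If \<open>a\<^sub>3 = 0\<close>, the determinant condition forces \<open>a\<^sub>1 = 0\<close> but says nothing about the biquadratic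
  polynomial that remains; its zeros are imaginary iff its discriminant in \<open>x\<^sup>2\<close> is nonnegative.\<close>

lemma quasi_hurwitz_4_iff:
  "f \<in> quasi_hurwitz 4 \<longleftrightarrow> f \<in> nonneg_polys 4 \<and>
     coeff f 0 * (coeff f 3)\<^sup>2 + (coeff f 1)\<^sup>2 * coeff f 4 \<le> coeff f 1 * coeff f 2 * coeff f 3 \<and>
     (coeff f 3 = 0 \<longrightarrow> 4 * coeff f 0 * coeff f 4 \<le> (coeff f 2)\<^sup>2)"
proof (cases "f \<in> nonneg_polys 4")
  case f: True
  let ?det = "coeff f 0 * (coeff f 3)\<^sup>2 + (coeff f 1)\<^sup>2 * coeff f 4 \<le> coeff f 1 * coeff f 2 * coeff f 3"
  let ?disc = "coeff f 3 = 0 \<longrightarrow> 4 * coeff f 0 * coeff f 4 \<le> (coeff f 2)\<^sup>2"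
  from f have deg: "degree f = 4" and pos: "coeff f 0 > 0" "coeff f 4 > 0"
    and nonneg: "\<And>i. coeff f i \<ge> 0"
    by (auto simp: nonneg_polys_def)
  have "?det \<and> ?disc" if roots: "\<forall>z. cpoly f z = 0 \<longrightarrow> Re z \<le> 0"
  proof
    obtain p q where d: "[:q, p, 1:] dvd f"
      using deg monic_quadratic_dvd_exists[of f] by auto
    obtain s r where s: "coeff f 0 = q * s" "coeff f 1 = p * s + q * r"
      "coeff f 2 = s + p * r + q * coeff f 4" "coeff f 3 = r + p * coeff f 4"
      and d': "[:s, r, coeff f 4:] dvd f"
      using quartic_factor[OF deg d] .
    have pr: "p \<ge> 0" "r \<ge> 0"
      using quadratic_dvd_linear_coeff_nonneg[OF d _ roots]
        quadratic_dvd_linear_coeff_nonneg[OF d' _ roots] pos by auto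
    then have "p * r * ((s - q * coeff f 4)\<^sup>2 + coeff f 1 * coeff f 3) \<ge> 0"
      using nonneg by simp
    then show ?det
      using hurwitz_det_quartic[OF s] by linarith
    show ?disc
    proof
      assume "coeff f 3 = 0"
      then have "r = 0"
        using s(4) pr pos by (simp add: add_nonneg_eq_0_iff)
      \<comment> \<open>With \<open>r = 0\<close>, \<open>coeff f 2\<close> is the sum and
        \<open>coeff f 0 * coeff f 4\<close> the product of \<open>s\<close> and
        \<open>q * coeff f 4\<close>, so the discriminant is a square.\<close>
      then have "(coeff f 2)\<^sup>2 - 4 * coeff f 0 * coeff f 4 = (s - q * coeff f 4)\<^sup>2"
        unfolding s(1,3) by (simp add: power2_eq_square algebra_simps)
      then show "4 * coeff f 0 * coeff f 4 \<le> (coeff f 2)\<^sup>2"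
        by (metis diff_ge_0_iff_ge zero_le_power2)
    qed
  qed
  moreover have "Re z \<le> 0" if det: ?det and disc: ?disc and "cpoly f z = 0" for z
    using that(3)
  proof (rule root_Re_cases)
    define p q where pq: "p = - 2 * Re z" "q = (cmod z)\<^sup>2"
    assume "[:(cmod z)\<^sup>2, - 2 * Re z, 1:] dvd f" and "(cmod z)\<^sup>2 > 0"
    then have d: "[:q, p, 1:] dvd f" and q: "q > 0" by (simp_all add: pq)
    obtain s r where s: "coeff f 0 = q * s" "coeff f 1 = p * s + q * r"
      "coeff f 2 = s + p * r + q * coeff f 4" "coeff f 3 = r + p * coeff f 4"
      using quartic_factor[OF deg d] .
    have "p \<ge> 0"
    proof (cases "coeff f 3 = 0")
      case False
      with nonneg[of 3] have a3: "coeff f 3 > 0" by linarith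
      \<comment> \<open>This term of the determinant condition is positive, so the right side cannot
        vanish; hence \<open>coeff f 1\<close> is nonzero and the factor next to
        \<open>p * r\<close> is positive.\<close>
      have "coeff f 0 * (coeff f 3)\<^sup>2 > 0"
        using pos a3 by simp
      with det have "coeff f 1 \<noteq> 0" by auto
      with nonneg[of 1] a3 have "(s - q * coeff f 4)\<^sup>2 + coeff f 1 * coeff f 3 > 0"
        by (intro add_nonneg_pos) auto
      moreover have "p * r * ((s - q * coeff f 4)\<^sup>2 + coeff f 1 * coeff f 3) \<ge> 0"
        using hurwitz_det_quartic[OF s] det by linarith
      ultimately have "p * r \<ge> 0"
        by (simp add: zero_le_mult_iff)
      moreover have "r > 0" if "p < 0"
        using s(4) a3 pos mult_neg_pos[OF that, of "coeff f 4"] by linarith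
      ultimately show ?thesis
        by (metis linorder_not_less mult_neg_pos)
    next
      case a3: True
      with det have "(coeff f 1)\<^sup>2 * coeff f 4 \<le> 0" by simp
      with pos have a1: "coeff f 1 = 0" by (simp add: mult_le_0_iff)
      have r: "r = - p * coeff f 4" using s(4) a3 by simp
      \<comment> \<open>This is the vanishing coefficient of \<open>x\<close> after substituting
        \<open>r = - p * coeff f 4\<close>.\<close>
      have "p * (s - q * coeff f 4) = 0"
        using s(2) a1 unfolding r right_diff_distrib by (simp add: mult_ac)
      then consider "p = 0" | "s = q * coeff f 4"
        by (metis mult_eq_0_iff right_minus_eq)
      then show ?thesis
      proof cases
        case 2
        \<comment> \<open>Here \<open>4 * coeff f 0 * coeff f 4\<close> is the square of
          \<open>?b\<close>. The discriminant condition gives \<open>?b \<le> coeff f 2\<close>,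
          while \<open>coeff f 2\<close> falls short of \<open>?b\<close> by
          \<open>p^2 * coeff f 4\<close>; this forces \<open>p = 0\<close>.\<close>
        let ?b = "2 * q * coeff f 4"
        have a2: "coeff f 2 = ?b - p\<^sup>2 * coeff f 4"
          unfolding s(3) r 2 by (simp add: power2_eq_square algebra_simps)
        have "?b\<^sup>2 \<le> (coeff f 2)\<^sup>2"
          using disc a3 unfolding s(1) 2 by (simp add: power2_eq_square algebra_simps)
        then have "?b \<le> coeff f 2"
          using nonneg[of 2] by (rule power2_le_imp_le)
        then have "p\<^sup>2 * coeff f 4 \<le> 0"
          using a2 by linarith
        then show ?thesis using pos by (simp add: mult_le_0_iff)
      qed simp
    qed
    then show "Re z \<le> 0" by (simp add: pq)
  qed (use pos nonneg in auto)
  ultimately show ?thesis using f by (auto simp: quasi_hurwitz_iff)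
qed (auto simp: quasi_hurwitz_iff)

section \<open>Preservation under Hadamard products with elements of \<open>W4_bar\<close>\<close>

lemma degree_hadamard:
  assumes "degree f \<le> degree g" "f \<noteq> 0" "coeff g (degree f) \<noteq> 0"
  shows "degree (hadamard f g) = degree f"
  using assms by (intro antisym degree_le le_degree) (auto simp: coeff_hadamard coeff_eq_0)

lemma hadamard_pos_polys:
  assumes "f \<in> pos_polys m" "g \<in> pos_polys n" "m \<le> n"
  shows "hadamard f g \<in> pos_polys m"
proof -
  have "coeff f m > 0" "coeff g m > 0" "degree f = m" "degree g = n"
    using assms by (auto simp: pos_polys_def)
  moreover from this have "f \<noteq> 0" by auto
  ultimately have "degree (hadamard f g) = m"
    using degree_hadamard[of f g] \<open>m \<le> n\<close> by simp
  then show ?thesis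
    using assms by (auto simp: pos_polys_def coeff_hadamard)
qed

lemma hadamard_nonneg_polys:
  assumes "f \<in> nonneg_polys m" "g \<in> pos_polys n" "m \<le> n"
  shows "hadamard f g \<in> nonneg_polys m"
proof -
  have "coeff f m > 0" "coeff g m > 0" "degree f = m" "degree g = n"
    using assms by (auto simp: pos_polys_def nonneg_polys_def)
  moreover from this have "f \<noteq> 0" by auto
  ultimately have "degree (hadamard f g) = m"
    using degree_hadamard[of f g] \<open>m \<le> n\<close> by simp
  then show ?thesis
    using assms pos_polys_coeff_nonneg[OF assms(2)]
    by (auto simp: pos_polys_def nonneg_polys_def coeff_hadamard)
qed

lemma W4_bar_iff:
  "g \<in> W4_bar \<longleftrightarrow> g \<in> pos_polys 4 \<and> coeff g 0 * coeff g 3 \<le> coeff g 1 * coeff g 2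
     \<and> coeff g 1 * coeff g 4 \<le> coeff g 2 * coeff g 3"
  by (auto simp: W4_bar_def mult.commute)

text \<open>The two inequalities of \<open>W4_bar\<close>, scaled by \<open>x * coeff g 3\<close>
  and \<open>y * coeff g 1\<close>, are added. For \<open>x\<close> and \<open>y\<close> the two
  subtracted terms of the quartic determinant of \<open>f\<close> will be inserted.\<close>

lemma W4_bar_quartic_bound:
  assumes g: "g \<in> W4_bar" and "x \<ge> 0" "y \<ge> 0"
  shows "x * coeff g 0 * (coeff g 3)\<^sup>2 + y * (coeff g 1)\<^sup>2 * coeff g 4
    \<le> (x + y) * (coeff g 1 * coeff g 2 * coeff g 3)"
proof -
  have pos: "coeff g 1 > 0" "coeff g 3 > 0"
    using g by (auto simp: W4_bar_def pos_polys_def)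
  have "(x * coeff g 3) * (coeff g 0 * coeff g 3) \<le> (x * coeff g 3) * (coeff g 1 * coeff g 2)"
    "(y * coeff g 1) * (coeff g 1 * coeff g 4) \<le> (y * coeff g 1) * (coeff g 2 * coeff g 3)"
    using g pos assms by (auto simp: W4_bar_iff intro!: mult_left_mono)
  then show ?thesis by (simp add: power2_eq_square algebra_simps)
qed

text \<open>Degrees 1 and 2 need only positive coefficients. In degrees 3 and 4 the strictness comes
  from the criterion for \<open>f\<close>, as \<open>g\<close> satisfies only weak
  inequalities.\<close>

lemma W4_bar_hurwitz:
  assumes g: "g \<in> W4_bar" and m: "m \<in> {1, 2, 3, 4}" and f: "f \<in> hurwitz m"
  shows "hadamard f g \<in> hurwitz m"
proof -
  have pg: "g \<in> pos_polys 4" and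
    W: "coeff g 0 * coeff g 3 \<le> coeff g 1 * coeff g 2" using g by (auto simp: W4_bar_iff)
  have bpos: "coeff g i > 0" if "i \<le> 4" for i using pg that by (auto simp: pos_polys_def)
  have pf: "f \<in> pos_polys m" using f by (simp add: hurwitz_def)
  then have h: "hadamard f g \<in> pos_polys m"
    using pg m by (intro hadamard_pos_polys) auto
  have apos: "coeff f i > 0" if "i \<le> m" for i using pf that by (auto simp: pos_polys_def)
  consider "m = 1" | "m = 2" | "m = 3" | "m = 4" using m by auto
  then show ?thesis
  proof cases
    case 3
    have "(coeff f 0 * coeff f 3) * (coeff g 0 * coeff g 3)
        < (coeff f 1 * coeff f 2) * (coeff g 1 * coeff g 2)"
      using f 3 W apos bpos
      by - (rule mult_less_le_imp_less, auto simp: hurwitz_3_iff less_imp_le)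
    then show ?thesis using h 3 by (simp add: hurwitz_3_iff coeff_hadamard mult_ac)
  next
    case 4
    let ?x = "coeff f 0 * (coeff f 3)\<^sup>2" and ?y = "(coeff f 1)\<^sup>2 * coeff f 4"
    have "?x * coeff g 0 * (coeff g 3)\<^sup>2 + ?y * (coeff g 1)\<^sup>2 * coeff g 4
        \<le> (?x + ?y) * (coeff g 1 * coeff g 2 * coeff g 3)"
      using apos 4 by (intro W4_bar_quartic_bound[OF g]) (auto simp: less_imp_le)
    also have "\<dots> < (coeff f 1 * coeff f 2 * coeff f 3) * (coeff g 1 * coeff g 2 * coeff g 3)"
      using f 4 bpos by (intro mult_strict_right_mono) (auto simp: hurwitz_4_iff)
    finally show ?thesis
      using h 4 by (simp add: hurwitz_4_iff coeff_hadamard power_mult_distrib mult_ac)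
  qed (use h hurwitz_1_iff hurwitz_2_iff in auto)
qed

text \<open>Multiplying the two inequalities and cancelling \<open>coeff g 1 * coeff g 3\<close>
  gives the claim. It serves the discriminant condition in
  \<open>quasi_hurwitz_4_iff\<close>.\<close>

lemma W4_bar_log_concave:
  assumes "g \<in> W4_bar"
  shows "coeff g 0 * coeff g 4 \<le> (coeff g 2)\<^sup>2"
proof -
  have pos: "coeff g i > 0" if "i \<le> 4" for i
    using assms that by (auto simp: W4_bar_def pos_polys_def)
  have "(coeff g 0 * coeff g 3) * (coeff g 1 * coeff g 4)
      \<le> (coeff g 1 * coeff g 2) * (coeff g 2 * coeff g 3)"
    using assms pos by - (rule mult_mono, auto simp: W4_bar_iff less_imp_le)
  then have "(coeff g 1 * coeff g 3) * (coeff g 0 * coeff g 4)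
      \<le> (coeff g 1 * coeff g 3) * (coeff g 2)\<^sup>2"
    by (simp add: power2_eq_square mult_ac)
  then show ?thesis using pos[of 1] pos[of 3] by simp
qed

lemma W4_bar_quasi_hurwitz:
  assumes g: "g \<in> W4_bar" and m: "m \<in> {1, 2, 3, 4}" and f: "f \<in> quasi_hurwitz m"
  shows "hadamard f g \<in> quasi_hurwitz m"
proof -
  have pg: "g \<in> pos_polys 4" and
    W: "coeff g 0 * coeff g 3 \<le> coeff g 1 * coeff g 2" using g by (auto simp: W4_bar_iff)
  have bpos: "coeff g i > 0" if "i \<le> 4" for i using pg that by (auto simp: pos_polys_def)
  have pf: "f \<in> nonneg_polys m" using f by (simp add: quasi_hurwitz_iff)
  then have h: "hadamard f g \<in> nonneg_polys m"
    using pg m by (intro hadamard_nonneg_polys) auto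
  have nonneg: "coeff f i \<ge> 0" for i using pf by (auto simp: nonneg_polys_def)
  consider "m = 1" | "m = 2" | "m = 3" | "m = 4" using m by auto
  then show ?thesis
  proof cases
    case 3
    have "(coeff f 0 * coeff f 3) * (coeff g 0 * coeff g 3)
        \<le> (coeff f 1 * coeff f 2) * (coeff g 1 * coeff g 2)"
      using f 3 W nonneg bpos
      by - (rule mult_mono, auto simp: quasi_hurwitz_3_iff less_imp_le)
    then show ?thesis using h 3 by (simp add: quasi_hurwitz_3_iff coeff_hadamard mult_ac)
  next
    case 4
    let ?x = "coeff f 0 * (coeff f 3)\<^sup>2" and ?y = "(coeff f 1)\<^sup>2 * coeff f 4"
    have "?x * coeff g 0 * (coeff g 3)\<^sup>2 + ?y * (coeff g 1)\<^sup>2 * coeff g 4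
        \<le> (?x + ?y) * (coeff g 1 * coeff g 2 * coeff g 3)"
      using nonneg by (intro W4_bar_quartic_bound[OF g]) auto
    also have "\<dots> \<le> (coeff f 1 * coeff f 2 * coeff f 3) * (coeff g 1 * coeff g 2 * coeff g 3)"
      using f 4 bpos by (intro mult_right_mono) (auto simp: quasi_hurwitz_4_iff less_imp_le)
    finally have det: "?x * coeff g 0 * (coeff g 3)\<^sup>2 + ?y * (coeff g 1)\<^sup>2 * coeff g 4
        \<le> (coeff f 1 * coeff f 2 * coeff f 3) * (coeff g 1 * coeff g 2 * coeff g 3)" .
    \<comment> \<open>The discriminant condition for \<open>f\<close> is multiplied by the
      log-concavity of \<open>g\<close>. Since \<open>coeff g 3 > 0\<close>, the cubic coefficient
      of the product vanishes only if that of \<open>f\<close> does.\<close>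
    have "(4 * coeff f 0 * coeff f 4) * (coeff g 0 * coeff g 4) \<le> (coeff f 2)\<^sup>2 * (coeff g 2)\<^sup>2"
      if "coeff f 3 = 0"
      using f 4 that nonneg bpos W4_bar_log_concave[OF g]
      by - (rule mult_mono, auto simp: quasi_hurwitz_4_iff less_imp_le)
    with det show ?thesis
      using h 4 bpos[of 3]
      by (auto simp: quasi_hurwitz_4_iff coeff_hadamard power_mult_distrib mult_ac)
  qed (use h quasi_hurwitz_1_iff quasi_hurwitz_2_iff in auto)
qed

lemma hurwitz_subset_quasi_hurwitz: "hurwitz n \<subseteq> quasi_hurwitz n"
  by (fastforce simp: hurwitz_def pos_polys_def quasi_hurwitz_def less_imp_le)

section \<open>Necessity of the inequalities by a limit argument\<close>

lemma le_of_le_mult_one_plus_eps: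
  fixes x y :: real
  assumes "\<And>e. e > 0 \<Longrightarrow> x \<le> y * (1 + e)" "y > 0"
  shows "x \<le> y"
proof (rule field_le_epsilon)
  fix e :: real assume "e > 0"
  then have "x \<le> y * (1 + e / y)" using assms by auto
  then show "x \<le> y + e" using assms(2) by (simp add: distrib_left)
qed

text \<open>The hypothesis takes strict Hurwitz inputs and asks only for quasi-Hurwitz outputs, so
  it follows from either preservation property, by
  \<open>hurwitz_subset_quasi_hurwitz\<close>.\<close>

lemma W4_bar_if_hurwitz:
  assumes g: "g \<in> pos_polys 4"
    and pres: "\<forall>m\<in>{3, 4}. \<forall>f\<in>hurwitz m. hadamard f g \<in> quasi_hurwitz m"
  shows "g \<in> W4_bar"
proof -
  have pos: "coeff g i > 0" if "i \<le> 4" for i using g that by (auto simp: pos_polys_def)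
  have "coeff g 0 * coeff g 3 \<le> coeff g 1 * coeff g 2"
  proof (rule le_of_le_mult_one_plus_eps)
    fix e :: real assume "e > 0"
    \<comment> \<open>The cubic criterion reads \<open>1 < 1 + e\<close> here.\<close>
    then have "[:1, 1, 1 + e, 1:] \<in> hurwitz 3"
      by (auto simp: hurwitz_3_iff pos_polys_def coeff_pCons split: nat.split)
    then have "hadamard [:1, 1, 1 + e, 1:] g \<in> quasi_hurwitz 3"
      using pres by auto
    then show "coeff g 0 * coeff g 3 \<le> coeff g 1 * coeff g 2 * (1 + e)"
      by (simp add: quasi_hurwitz_3_iff coeff_hadamard coeff_pCons mult_ac)
  qed (use pos in auto)
  moreover have "coeff g 1 * coeff g 4 \<le> coeff g 2 * coeff g 3"
  proof (rule le_of_le_mult_one_plus_eps)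
    fix e :: real assume e: "e > 0"
    \<comment> \<open>The constant term must be positive yet vanish in the limit; with
      \<open>e / 2\<close> the quartic criterion reads \<open>e / 2 + 1 < 1 + e\<close>.\<close>
    then have "[:e / 2, 1, 1 + e, 1, 1:] \<in> hurwitz 4"
      by (auto simp: hurwitz_4_iff pos_polys_def coeff_pCons split: nat.split)
    then have "hadamard [:e / 2, 1, 1 + e, 1, 1:] g \<in> quasi_hurwitz 4"
      using pres by auto
    then have "e / 2 * coeff g 0 * (coeff g 3)\<^sup>2 + (coeff g 1)\<^sup>2 * coeff g 4
        \<le> coeff g 1 * ((1 + e) * coeff g 2) * coeff g 3"
      by (simp add: quasi_hurwitz_4_iff coeff_hadamard coeff_pCons)
    moreover have "e / 2 * coeff g 0 * (coeff g 3)\<^sup>2 \<ge> 0"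
      using e pos[of 0] by simp
    ultimately have "coeff g 1 * (coeff g 1 * coeff g 4)
        \<le> coeff g 1 * (coeff g 2 * coeff g 3 * (1 + e))"
      by (simp add: power2_eq_square mult_ac)
    then show "coeff g 1 * coeff g 4 \<le> coeff g 2 * coeff g 3 * (1 + e)"
      using pos[of 1] by simp
  qed (use pos in auto)
  ultimately show ?thesis using g by (simp add: W4_bar_iff)
qed

section \<open>The conditions on \<open>Q\<close> and the set \<open>Y 4\<close>\<close>

text \<open>The division is exact, so the quotient is the cofactor of \<open>monom 1 m\<close>, and
  its coefficients are those of the product shifted by \<open>m\<close>.\<close>

lemma coeff_hadamard_Q_quot:
  "coeff (hadamard_Q_quot g m k) i = coeff g (i + m) * coeff (Q k) i"
proof -
  obtain q where q: "hadamard g (Q_shift m k) = monom 1 m * q"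
    using monom_dvd_hadamard_Q_shift[of m g k] by (auto simp: dvd_def)
  then have "hadamard_Q_quot g m k = q"
    by (simp add: hadamard_Q_quot_def)
  moreover have "coeff (monom 1 m * q) (i + m) = coeff q i"
    by (simp add: coeff_monom_mult)
  ultimately show ?thesis
    by (simp flip: q add: coeff_hadamard Q_shift_def coeff_monom_mult)
qed

lemma hadamard_Q_quot_2: "hadamard_Q_quot g m 2 = [:coeff g m, 0, coeff g (m + 2):]"
  by (intro poly_eqI) (auto simp: coeff_hadamard_Q_quot Q_def coeff_pCons split: nat.split)

lemma hadamard_Q_quot_3:
  "hadamard_Q_quot g m 3 = [:coeff g m, coeff g (m + 1), coeff g (m + 2), coeff g (m + 3):]"
proof -
  have "Q 3 = [:1, 1, 1, 1:]"
    by (simp add: Q_def)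
  then show ?thesis
    by (intro poly_eqI) (simp only: coeff_hadamard_Q_quot,
      simp add: coeff_pCons eval_nat_numeral split: nat.split)
qed

lemma hadamard_Q_quot_4:
  "hadamard_Q_quot g m 4 = [:coeff g m, 0, 2 * coeff g (m + 2), 0, coeff g (m + 4):]"
proof -
  have "Q 4 = [:1, 0, 2, 0, 1:]"
    by (simp add: Q_def power2_eq_square)
  then show ?thesis
    by (intro poly_eqI) (simp only: coeff_hadamard_Q_quot,
      simp add: coeff_pCons eval_nat_numeral split: nat.split)
qed

text \<open>The quotient lists four consecutive positive coefficients of \<open>g\<close>, so of the
  cubic criterion only the determinant inequality remains.\<close>

lemma hadamard_Q_quot_3_quasi_hurwitz_iff:
  assumes "\<And>i. i \<le> 3 \<Longrightarrow> coeff g (m + i) > 0"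
  shows "hadamard_Q_quot g m 3 \<in> quasi_hurwitz 3 \<longleftrightarrow>
    coeff g m * coeff g (m + 3) \<le> coeff g (m + 1) * coeff g (m + 2)"
  using assms[of 0] assms[of 1] assms[of 2] assms[of 3]
  unfolding hadamard_Q_quot_3 quasi_hurwitz_3_iff
  by (auto simp: nonneg_polys_def coeff_pCons split: nat.split)

lemma W4_bar_iff_Q:
  assumes "g \<in> pos_polys 4"
  shows "g \<in> W4_bar \<longleftrightarrow> (\<forall>i\<in>{0, 1}. hadamard_Q_quot g i 3 \<in> quasi_hurwitz 3)"
  using assms hadamard_Q_quot_3_quasi_hurwitz_iff[of g 0] hadamard_Q_quot_3_quasi_hurwitz_iff[of g 1]
  by (auto simp: W4_bar_iff pos_polys_def simp flip: numeral_2_eq_2)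

text \<open>The case \<open>k = 3\<close> alone gives \<open>W4_bar\<close>. Conversely
  \<open>k = 2\<close> needs only positivity, and \<open>k = 4\<close> follows from
  log-concavity.\<close>

lemma Y_4_eq: "Y 4 = W4_bar"
proof (intro set_eqI iffI)
  fix g assume "g \<in> Y 4"
  then show "g \<in> W4_bar"
    by (subst W4_bar_iff_Q) (auto simp: Y_def)
next
  fix g assume g: "g \<in> W4_bar"
  then have pg: "g \<in> pos_polys 4" by (simp add: W4_bar_iff)
  then have pos: "coeff g i > 0" if "i \<le> 4" for i using that by (auto simp: pos_polys_def)
  have "hadamard_Q_quot g m k \<in> quasi_hurwitz k" if km: "k \<ge> 2" "k + m \<le> 4" for k m
  proof -
    consider "k = 2" | "k = 3" | "k = 4" using km by linarith
    then show ?thesis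
    proof cases
      case 1
      then show ?thesis using pos[of m] pos[of "m + 2"] km
        by (auto simp: hadamard_Q_quot_2 quasi_hurwitz_2_iff nonneg_polys_def coeff_pCons
            split: nat.split)
    next
      case 2
      then have "m \<in> {0, 1}" using km by auto
      then show ?thesis using g W4_bar_iff_Q[OF pg] 2 by blast
    next
      case 3
      \<comment> \<open>Here \<open>m = 0\<close>. The odd coefficients vanish, so the determinant
        condition is trivial and the discriminant condition reads
        \<open>4 * b0 * b4 \<le> (2 * b2)^2\<close>, where \<open>bi\<close> stands for
        \<open>coeff g i\<close>.\<close>
      then show ?thesis using pos[of 0] pos[of 2] pos[of 4] km W4_bar_log_concave[OF g]
        by (auto simp: hadamard_Q_quot_4 quasi_hurwitz_4_iff nonneg_polys_def coeff_pCons
            power2_eq_square split: nat.split simp flip: numeral_2_eq_2)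
    qed
  qed
  with pg show "g \<in> Y 4" by (simp add: Y_def)
qed

section \<open>The equivalences and the equality of the three sets\<close>

lemma W4_bar_iff_hurwitz:
  assumes "g \<in> pos_polys 4"
  shows "(\<forall>m\<in>{1, 2, 3, 4}. \<forall>f\<in>hurwitz m. hadamard f g \<in> hurwitz m) \<longleftrightarrow> g \<in> W4_bar"
proof
  assume "\<forall>m\<in>{1, 2, 3, 4}. \<forall>f\<in>hurwitz m. hadamard f g \<in> hurwitz m"
  then show "g \<in> W4_bar"
    by (intro W4_bar_if_hurwitz[OF assms])
      (auto intro: subsetD[OF hurwitz_subset_quasi_hurwitz])
qed (simp add: W4_bar_hurwitz)

lemma W4_bar_iff_quasi_hurwitz:
  assumes "g \<in> pos_polys 4"
  shows "(\<forall>m\<in>{1, 2, 3, 4}. \<forall>f\<in>quasi_hurwitz m. hadamard f g \<in> quasi_hurwitz m)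
    \<longleftrightarrow> g \<in> W4_bar"
proof
  assume "\<forall>m\<in>{1, 2, 3, 4}. \<forall>f\<in>quasi_hurwitz m. hadamard f g \<in> quasi_hurwitz m"
  then show "g \<in> W4_bar"
    by (intro W4_bar_if_hurwitz[OF assms])
      (auto intro: subsetD[OF hurwitz_subset_quasi_hurwitz])
qed (simp add: W4_bar_quasi_hurwitz)

lemma X_4_eq: "X 4 = W4_bar"
proof -
  have range: "{1, 2, 3, 4} = {m::nat. 1 \<le> m \<and> m \<le> 4}" by auto
  have "g \<in> X 4 \<longleftrightarrow> g \<in> W4_bar" for g
  proof (cases "g \<in> pos_polys 4")
    case True
    show ?thesis
      unfolding W4_bar_iff_hurwitz[OF True, symmetric] range using True by (simp add: X_def)
  next
    case False
    then show ?thesis by (simp add: X_def W4_bar_iff)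
  qed
  then show ?thesis by blast
qed

theorem theorem8:
  fixes g :: "real poly"
  assumes "g \<in> pos_polys 4"
  shows "((\<forall>m\<in>{1, 2, 3, 4}. \<forall>f\<in>hurwitz m. hadamard f g \<in> hurwitz m)
            \<longleftrightarrow> (\<forall>i\<in>{0, 1}. hadamard_Q_quot g i 3 \<in> quasi_hurwitz 3))
       \<and> ((\<forall>m\<in>{1, 2, 3, 4}. \<forall>f\<in>quasi_hurwitz m. hadamard f g \<in> quasi_hurwitz m)
            \<longleftrightarrow> (\<forall>i\<in>{0, 1}. hadamard_Q_quot g i 3 \<in> quasi_hurwitz 3))
       \<and> X 4 = Y 4 \<and> Y 4 = W4_bar"
  unfolding W4_bar_iff_hurwitz[OF assms] W4_bar_iff_quasi_hurwitz[OF assms]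
    W4_bar_iff_Q[OF assms] X_4_eq Y_4_eq by simp

end
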